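(* Let $G$ be a finitely generated group which is shortlex combable with respect to a finite symmetric generating set $S$ equipped with some linear order, and let $d_S$ be the word metric on $G$ given by $S$. Then the Lipschitz-free space $\mathcal{F}(G,d_S)$ has a Schauder basis.
   Context: Let $G$ be a finitely generated group and $S\subseteq G$ a finite symmetric generating set ($s\in S$ implies $s^{-1}\in S$). The word metric is $d_S(g,g)=0$ and, for $g\neq h$, $d_S(g,h)=\min\{n\in\mathbb{N}: \exists s_1,\ldots,s_n\in S\ (g=hs_1\cdots s_n)\}$. Fix a linear order on $S$. Let $W$ be the set of all reduced words over the alphabet $S$, i.e. finite strings $s_1s_2\ldots s_n$ of elements of $S$ such that for no $i<n$ the letters $s_i$ and $s_{i+1}$ are inverses of each other as group elements. For $w\in W$, $|w|$ is the length of $w$, $w_G\in G$ is the group element obtained by evaluating $w$ in $G$, and $w(\leq i)$ is the word consisting of the first $i$ letters of $w$. Let $\preceq'$ be the lexicographical order on $W$ induced by the linear order on $S$. The shortlex order $\preceq$ on $W$ is: $w\preceq v$ if either $|w|<|v|$, or $|w|=|v|$ and $w\preceq' v$. For $g\in G$, let $w_g$ be the $\preceq$-minimal element of $\{w\in W: w_G=g\}$ (one has $|w_g|=d_S(g,1_G)$). $G$ is called shortlex combable, with respect to $S$ and the fixed linear order on $S$, if there exists a constant $K\geq 1$ such that for every $g,h\in G$ with $d_S(g,h)=1$ and every $i\leq \min\{d_S(g,1_G),d_S(h,1_G)\}$ we have $d_S\big((w_g(\leq i))_G,(w_h(\leq i))_G\big)\leq K$. For a metric space $M$ with a distinguished point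 $0\in M$, $\mathrm{Lip}_0(M)$ is the Banach space of real-valued Lipschitz functions on $M$ vanishing at $0$, normed by the minimal Lipschitz constant. The Lipschitz-free space $\mathcal{F}(M)$ is the closed linear span of $\{\delta(x):x\in M\}$ in $\mathrm{Lip}_0(M)^*$, where $\delta(x)(f)=f(x)$ (up to linear isometry it does not depend on the choice of $0$). *)

theory Defs
  imports "HOL-Analysis.Analysis" "HOL-Algebra.Generated_Groups"
begin

section \<open>Word metrics and shortlex combable groups\<close>

definition word_eval :: "('a, 'b) monoid_scheme \<Rightarrow> 'a list \<Rightarrow> 'a" where
  "word_eval G w = foldr (\<lambda>s x. s \<otimes>\<^bsub>G\<^esub> x) w \<one>\<^bsub>G\<^esub>"

definition symmetric_generating_set :: "('a, 'b) monoid_scheme \<Rightarrow> 'a set \<Rightarrow> bool" where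
  "symmetric_generating_set G S \<longleftrightarrow>
     S \<subseteq> carrier G \<and> (\<forall>s\<in>S. inv\<^bsub>G\<^esub> s \<in> S) \<and> generate G S = carrier G"

definition word_dist :: "('a, 'b) monoid_scheme \<Rightarrow> 'a set \<Rightarrow> 'a \<Rightarrow> 'a \<Rightarrow> nat" where
  "word_dist G S g h =
     (if g = h then 0
      else LEAST n. \<exists>w. length w = n \<and> set w \<subseteq> S \<and> g = h \<otimes>\<^bsub>G\<^esub> word_eval G w)"

text \<open>The locale \<^locale>\<open>Metric_space\<close> demands symmetry and non-negativity on the whole type,
  hence the default value outside the carrier.\<close>

definition word_metric :: "('a, 'b) monoid_scheme \<Rightarrow> 'a set \<Rightarrow> 'a metric" where
  "word_metric G S = metric (carrier G,
     \<lambda>g h. if g \<in> carrier G \<and> h \<in> carrier G then real (word_dist G S g h) else 0)"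

definition reduced_words :: "('a, 'b) monoid_scheme \<Rightarrow> 'a set \<Rightarrow> 'a list set" where
  "reduced_words G S =
     {w. set w \<subseteq> S \<and> (\<forall>i. Suc i < length w \<longrightarrow> w ! Suc i \<noteq> inv\<^bsub>G\<^esub> (w ! i))}"

text \<open>The argument \<open>r\<close> is a reflexive linear order, whereas \<^const>\<open>lenlex\<close> expects and
  yields strict orders.\<close>

definition shortlex_le :: "('a \<times> 'a) set \<Rightarrow> 'a list \<Rightarrow> 'a list \<Rightarrow> bool" where
  "shortlex_le r w v \<longleftrightarrow> w = v \<or> (w, v) \<in> lenlex (r - Id)"

definition shortlex_rep ::
  "('a, 'b) monoid_scheme \<Rightarrow> 'a set \<Rightarrow> ('a \<times> 'a) set \<Rightarrow> 'a \<Rightarrow> 'a list" where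
  "shortlex_rep G S r g =
     (THE w. w \<in> reduced_words G S \<and> word_eval G w = g \<and>
        (\<forall>v \<in> reduced_words G S. word_eval G v = g \<longrightarrow> shortlex_le r w v))"

definition shortlex_combable ::
  "('a, 'b) monoid_scheme \<Rightarrow> 'a set \<Rightarrow> ('a \<times> 'a) set \<Rightarrow> bool" where
  "shortlex_combable G S r \<longleftrightarrow>
     (\<exists>K::real. K \<ge> 1 \<and>
       (\<forall>g \<in> carrier G. \<forall>h \<in> carrier G. word_dist G S g h = 1 \<longrightarrow>
         (\<forall>i \<le> min (word_dist G S g \<one>\<^bsub>G\<^esub>) (word_dist G S h \<one>\<^bsub>G\<^esub>).
            real (word_dist G S (word_eval G (take i (shortlex_rep G S r g)))
                                (word_eval G (take i (shortlex_rep G S r h)))) \<le> K)))"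


section \<open>Lipschitz-free spaces\<close>

text \<open>Since the metric space is a term and not a type, the normed spaces below are sets of
  real-valued functions, with pointwise operations, together with a norm on them.
  Functions are extended by \<open>0\<close> outside their domain, so that each element has exactly one
  representative and pointwise operations stay within the sets.\<close>

definition Lip0 :: "'a metric \<Rightarrow> 'a \<Rightarrow> ('a \<Rightarrow> real) set" where
  "Lip0 m p = {f. Lipschitz_continuous_map m euclidean_metric f \<and> f p = 0 \<and>
                  (\<forall>x. x \<notin> mspace m \<longrightarrow> f x = 0)}"

definition Lip_norm :: "'a metric \<Rightarrow> ('a \<Rightarrow> real) \<Rightarrow> real" where
  "Lip_norm m f =
     Inf {L. L \<ge> 0 \<and> (\<forall>x \<in> mspace m. \<forall>y \<in> mspace m. \<bar>f x - f y\<bar> \<le> L * mdist m x y)}"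

definition Lip0_dual :: "'a metric \<Rightarrow> 'a \<Rightarrow> (('a \<Rightarrow> real) \<Rightarrow> real) set" where
  "Lip0_dual m p = {\<phi>.
     (\<forall>f \<in> Lip0 m p. \<forall>g \<in> Lip0 m p. \<phi> (\<lambda>x. f x + g x) = \<phi> f + \<phi> g) \<and>
     (\<forall>c. \<forall>f \<in> Lip0 m p. \<phi> (\<lambda>x. c * f x) = c * \<phi> f) \<and>
     (\<exists>B. \<forall>f \<in> Lip0 m p. \<bar>\<phi> f\<bar> \<le> B * Lip_norm m f) \<and>
     (\<forall>f. f \<notin> Lip0 m p \<longrightarrow> \<phi> f = 0)}"

definition Lip0_dual_norm :: "'a metric \<Rightarrow> 'a \<Rightarrow> (('a \<Rightarrow> real) \<Rightarrow> real) \<Rightarrow> real" where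
  "Lip0_dual_norm m p \<phi> = Sup {\<bar>\<phi> f\<bar> | f. f \<in> Lip0 m p \<and> Lip_norm m f \<le> 1}"

definition evaluation :: "'a metric \<Rightarrow> 'a \<Rightarrow> 'a \<Rightarrow> ('a \<Rightarrow> real) \<Rightarrow> real" where
  "evaluation m p x = (\<lambda>f. if f \<in> Lip0 m p then f x else 0)"

definition evaluation_span :: "'a metric \<Rightarrow> 'a \<Rightarrow> (('a \<Rightarrow> real) \<Rightarrow> real) set" where
  "evaluation_span m p =
     {(\<lambda>f. \<Sum>x\<in>A. c x * evaluation m p x f) | A c. finite A \<and> A \<subseteq> mspace m}"

definition Lipschitz_free :: "'a metric \<Rightarrow> 'a \<Rightarrow> (('a \<Rightarrow> real) \<Rightarrow> real) set" where
  "Lipschitz_free m p =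
     {\<phi> \<in> Lip0_dual m p.
        \<forall>\<epsilon>>0. \<exists>\<psi> \<in> evaluation_span m p. Lip0_dual_norm m p (\<lambda>f. \<phi> f - \<psi> f) < \<epsilon>}"


section \<open>Schauder bases\<close>

text \<open>A basis is indexed by \<open>I\<close>, which is either all of \<open>\<nat>\<close> or, for finite-dimensional spaces,
  an initial segment of \<open>\<nat>\<close>. Scalar sequences vanish outside \<open>I\<close>, so that uniqueness of the
  expansion concerns only the coefficients with index in \<open>I\<close>.\<close>

definition Schauder_basis ::
  "('x \<Rightarrow> real) set \<Rightarrow> (('x \<Rightarrow> real) \<Rightarrow> real) \<Rightarrow> nat set \<Rightarrow> (nat \<Rightarrow> 'x \<Rightarrow> real) \<Rightarrow> bool" where
  "Schauder_basis V N I e \<longleftrightarrow>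
     (I = UNIV \<or> (\<exists>n. I = {..<n})) \<and>
     (\<forall>i \<in> I. e i \<in> V) \<and>
     (\<forall>v \<in> V. \<exists>!a :: nat \<Rightarrow> real.
        (\<forall>i. i \<notin> I \<longrightarrow> a i = 0) \<and>
        (\<lambda>n. N (\<lambda>x. v x - (\<Sum>i \<in> I \<inter> {..<n}. a i * e i x))) \<longlonglongrightarrow> 0)"

definition has_Schauder_basis :: "('x \<Rightarrow> real) set \<Rightarrow> (('x \<Rightarrow> real) \<Rightarrow> real) \<Rightarrow> bool" where
  "has_Schauder_basis V N \<longleftrightarrow> (\<exists>I e. Schauder_basis V N I e)"


section \<open>The word metric is a metric\<close>

lemma word_eval_closed:
  assumes "group G" "set w \<subseteq> carrier G"
  shows "word_eval G w \<in> carrier G"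
proof -
  interpret group G by fact
  show ?thesis using assms(2) by (induction w) (auto simp: word_eval_def)
qed

lemma word_eval_append:
  assumes "group G" "set u \<subseteq> carrier G" "set v \<subseteq> carrier G"
  shows "word_eval G (u @ v) = word_eval G u \<otimes>\<^bsub>G\<^esub> word_eval G v"
proof -
  interpret group G by fact
  show ?thesis
    using assms(2)
  proof (induction u)
    case Nil
    then show ?case using word_eval_closed[OF assms(1,3)] by (simp add: word_eval_def)
  next
    case (Cons s u)
    then show ?case
      using word_eval_closed[OF assms(1), of u] word_eval_closed[OF assms(1,3)]
      by (simp add: word_eval_def m_assoc)
  qed
qed

lemma word_eval_rev_inv:
  assumes "group G" "set w \<subseteq> carrier G"
  shows "word_eval G (rev (map (\<lambda>s. inv\<^bsub>G\<^esub> s) w)) = inv\<^bsub>G\<^esub> (word_eval G w)"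
proof -
  interpret group G by fact
  show ?thesis
    using assms(2)
  proof (induction w)
    case Nil
    then show ?case by (simp add: word_eval_def)
  next
    case (Cons s w)
    have "set (rev (map (\<lambda>s. inv\<^bsub>G\<^esub> s) w)) \<subseteq> carrier G" "set [inv\<^bsub>G\<^esub> s] \<subseteq> carrier G"
      using Cons.prems by auto
    from word_eval_append[OF assms(1) this] Cons show ?case
      using word_eval_closed[OF assms(1), of w]
      by (simp add: word_eval_def inv_mult_group)
  qed
qed

lemma word_eval_surj:
  assumes "group G" "symmetric_generating_set G S" "g \<in> carrier G"
  shows "\<exists>w. set w \<subseteq> S \<and> word_eval G w = g"
proof -
  interpret group G by fact
  have S: "S \<subseteq> carrier G" "\<And>s. s \<in> S \<Longrightarrow> inv\<^bsub>G\<^esub> s \<in> S" "g \<in> generate G S"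
    using assms by (auto simp: symmetric_generating_set_def)
  have single: "set [s] \<subseteq> S \<and> word_eval G [s] = s" if "s \<in> S" for s
    using that S(1) by (auto simp: word_eval_def)
  from S(3) show ?thesis
  proof induction
    case one
    show ?case by (rule exI[of _ "[]"]) (simp add: word_eval_def)
  next
    case (incl h)
    then show ?case using single by blast
  next
    case (inv h)
    then show ?case using single S(2) by blast
  next
    case (eng h1 h2)
    then obtain u v where "set u \<subseteq> S" "word_eval G u = h1" "set v \<subseteq> S" "word_eval G v = h2"
      by blast
    then show ?case
      using word_eval_append[OF assms(1), of u v] S(1) by (intro exI[of _ "u @ v"]) auto
  qed
qed

lemma word_dist_le:
  assumes "set w \<subseteq> S" "g = h \<otimes>\<^bsub>G\<^esub> word_eval G w"
  shows "word_dist G S g h \<le> length w"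
  unfolding word_dist_def using assms by (auto intro!: Least_le)

lemma word_dist_witness:
  assumes "group G" "symmetric_generating_set G S" "g \<in> carrier G" "h \<in> carrier G"
  shows "\<exists>w. length w = word_dist G S g h \<and> set w \<subseteq> S \<and> g = h \<otimes>\<^bsub>G\<^esub> word_eval G w"
proof (cases "g = h")
  case True
  interpret group G by fact
  show ?thesis using True assms by (intro exI[of _ "[]"]) (simp add: word_dist_def word_eval_def)
next
  case False
  interpret group G by fact
  obtain w where "set w \<subseteq> S" "word_eval G w = inv\<^bsub>G\<^esub> h \<otimes>\<^bsub>G\<^esub> g"
    using word_eval_surj[OF assms(1,2)] assms(3,4) by (meson inv_closed m_closed)
  then have "\<exists>n w. length w = n \<and> set w \<subseteq> S \<and> g = h \<otimes>\<^bsub>G\<^esub> word_eval G w"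
    using assms(3,4) by (metis inv_closed l_one m_assoc r_inv)
  from LeastI_ex[OF this] False show ?thesis by (simp add: word_dist_def)
qed

lemma word_dist_commute_le:
  assumes "group G" "symmetric_generating_set G S" "g \<in> carrier G" "h \<in> carrier G"
  shows "word_dist G S h g \<le> word_dist G S g h"
proof -
  interpret group G by fact
  obtain w where w: "length w = word_dist G S g h" "set w \<subseteq> S" "g = h \<otimes>\<^bsub>G\<^esub> word_eval G w"
    using word_dist_witness[OF assms] by blast
  have S: "S \<subseteq> carrier G" "\<And>s. s \<in> S \<Longrightarrow> inv\<^bsub>G\<^esub> s \<in> S"
    using assms(2) by (auto simp: symmetric_generating_set_def)
  have wc: "set w \<subseteq> carrier G" using w(2) S(1) by blast
  have "h = g \<otimes>\<^bsub>G\<^esub> word_eval G (rev (map (\<lambda>s. inv\<^bsub>G\<^esub> s) w))"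
    using word_eval_rev_inv[OF assms(1) wc] word_eval_closed[OF assms(1) wc] w(3) assms(4)
    by (simp add: m_assoc)
  moreover have "set (rev (map (\<lambda>s. inv\<^bsub>G\<^esub> s) w)) \<subseteq> S" using w(2) S(2) by auto
  ultimately show ?thesis using word_dist_le w(1) by (metis length_map length_rev)
qed

lemma word_dist_commute:
  assumes "group G" "symmetric_generating_set G S" "g \<in> carrier G" "h \<in> carrier G"
  shows "word_dist G S g h = word_dist G S h g"
  using word_dist_commute_le[OF assms] word_dist_commute_le[OF assms(1,2,4,3)] by simp

lemma word_dist_eq_0_iff:
  assumes "group G" "symmetric_generating_set G S" "g \<in> carrier G" "h \<in> carrier G"
  shows "word_dist G S g h = 0 \<longleftrightarrow> g = h"
proof
  interpret group G by fact
  show "g = h" if "word_dist G S g h = 0"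
    using word_dist_witness[OF assms] that assms(4) by (auto simp: word_eval_def)
qed (simp add: word_dist_def)

lemma word_dist_triangle:
  assumes "group G" "symmetric_generating_set G S"
    and x: "x \<in> carrier G" and y: "y \<in> carrier G" and z: "z \<in> carrier G"
  shows "word_dist G S x z \<le> word_dist G S x y + word_dist G S y z"
proof -
  interpret group G by fact
  have S: "S \<subseteq> carrier G" using assms(2) by (auto simp: symmetric_generating_set_def)
  obtain u v where u: "length u = word_dist G S x y" "set u \<subseteq> S" "x = y \<otimes>\<^bsub>G\<^esub> word_eval G u"
    and v: "length v = word_dist G S y z" "set v \<subseteq> S" "y = z \<otimes>\<^bsub>G\<^esub> word_eval G v"
    using word_dist_witness[OF assms(1,2) x y] word_dist_witness[OF assms(1,2) y z] by blast
  have c: "set u \<subseteq> carrier G" "set v \<subseteq> carrier G" using u v S by auto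
  have "x = z \<otimes>\<^bsub>G\<^esub> word_eval G (v @ u)"
    using u(3) v(3) z word_eval_append[OF assms(1) c(2,1)] word_eval_closed[OF assms(1) c(1)]
      word_eval_closed[OF assms(1) c(2)]
    by (simp add: m_assoc)
  then have "word_dist G S x z \<le> length (v @ u)"
    using u v by (intro word_dist_le) auto
  then show ?thesis using u v by simp
qed

lemma Metric_space_word_dist:
  assumes "group G" "symmetric_generating_set G S"
  shows "Metric_space (carrier G)
    (\<lambda>g h. if g \<in> carrier G \<and> h \<in> carrier G then real (word_dist G S g h) else 0)"
proof
  fix x y z
  assume "x \<in> carrier G" "y \<in> carrier G" "z \<in> carrier G"
  then show "(if x \<in> carrier G \<and> z \<in> carrier G then real (word_dist G S x z) else 0)
    \<le> (if x \<in> carrier G \<and> y \<in> carrier G then real (word_dist G S x y) else 0)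
      + (if y \<in> carrier G \<and> z \<in> carrier G then real (word_dist G S y z) else 0)"
    using word_dist_triangle[OF assms, of x y z] by simp
qed (use word_dist_commute[OF assms] word_dist_eq_0_iff[OF assms] in simp_all)

lemma mspace_word_metric:
  assumes "group G" "symmetric_generating_set G S"
  shows "mspace (word_metric G S) = carrier G"
  unfolding word_metric_def by (rule Metric_space.mspace_metric[OF Metric_space_word_dist[OF assms]])

lemma mdist_word_metric:
  assumes "group G" "symmetric_generating_set G S" "g \<in> carrier G" "h \<in> carrier G"
  shows "mdist (word_metric G S) g h = real (word_dist G S g h)"
  unfolding word_metric_def
  using Metric_space.mdist_metric[OF Metric_space_word_dist[OF assms(1,2)]] assms(3,4) by simp


section \<open>Existence and uniqueness of shortlex representatives\<close>

lemma ex_reduced_word: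
  assumes "group G" "symmetric_generating_set G S" "g \<in> carrier G"
  shows "\<exists>w \<in> reduced_words G S. word_eval G w = g"
proof -
  interpret group G by fact
  have S: "S \<subseteq> carrier G" using assms(2) by (auto simp: symmetric_generating_set_def)
  define P where "P w \<longleftrightarrow> set w \<subseteq> S \<and> word_eval G w = g" for w
  obtain w where w: "P w" "\<And>v. P v \<Longrightarrow> length w \<le> length v"
    using word_eval_surj[OF assms] ex_has_least_nat[of P _ length] unfolding P_def by metis
  have "w ! Suc i \<noteq> inv\<^bsub>G\<^esub> (w ! i)" if i: "Suc i < length w" for i
  proof
    assume eq: "w ! Suc i = inv\<^bsub>G\<^esub> (w ! i)"
    define u v where "u = take i w" and "v = drop (Suc (Suc i)) w"
    have split: "w = u @ ([w ! i, w ! Suc i] @ v)"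
      unfolding u_def v_def using i
      by (metis Cons_nth_drop_Suc Suc_lessD append_Cons append_Nil append_take_drop_id)
    have "set w \<subseteq> S" using w(1) by (simp add: P_def)
    then have uv: "set u \<subseteq> S" "set v \<subseteq> S" and s: "w ! i \<in> S" "w ! Suc i \<in> S"
      using i by (auto simp: u_def v_def dest: in_set_takeD in_set_dropD)
    have c: "set u \<subseteq> carrier G" "set v \<subseteq> carrier G" "set [w ! i, w ! Suc i] \<subseteq> carrier G"
      "set ([w ! i, w ! Suc i] @ v) \<subseteq> carrier G"
      using uv s S by auto
    have "word_eval G [w ! i, w ! Suc i] = \<one>\<^bsub>G\<^esub>"
      using s(1) S eq by (auto simp: word_eval_def)
    then have "word_eval G ([w ! i, w ! Suc i] @ v) = word_eval G v"
      using word_eval_append[OF assms(1) c(3,2)] word_eval_closed[OF assms(1) c(2)] by simp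
    then have "word_eval G (u @ v) = word_eval G w"
      using word_eval_append[OF assms(1) c(1,4)] word_eval_append[OF assms(1) c(1,2)] split by metis
    then have "P (u @ v)" using uv w(1) by (simp add: P_def)
    moreover have "length (u @ v) < length w" using i by (simp add: u_def v_def)
    ultimately show False using w(2) by fastforce
  qed
  then show ?thesis using w(1) by (auto simp: P_def reduced_words_def)
qed

lemma ex1_shortlex_rep:
  assumes "group G" "finite S" "symmetric_generating_set G S" "linear_order_on S r" "g \<in> carrier G"
  shows "\<exists>!w. w \<in> reduced_words G S \<and> word_eval G w = g \<and>
           (\<forall>v \<in> reduced_words G S. word_eval G v = g \<longrightarrow> shortlex_le r w v)"
proof -
  have r: "r \<subseteq> S \<times> S" "trans r" "antisym r" "total_on S r"
    using assms(4) by (auto simp: order_on_defs)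
  have strict: "trans (r - Id)" "irrefl (r - Id)" "total_on S (r - Id)"
    using r by (auto intro: trans_diff_Id simp: irrefl_def total_on_def)
  have "finite (r - Id)" using r(1) assms(2) by (meson finite_Diff finite_SigmaI finite_subset)
  moreover have "acyclic (r - Id)" using strict by (simp add: acyclic_irrefl)
  ultimately have wf: "wf (lenlex (r - Id))" by (intro wf_lenlex finite_acyclic_wf)
  have total: "(u, v) \<in> lenlex (r - Id) \<or> u = v \<or> (v, u) \<in> lenlex (r - Id)"
    if "set u \<subseteq> S" "set v \<subseteq> S" for u v
  proof (cases "length u = length v")
    case True
    then show ?thesis using that
    proof (induction u v rule: list_induct2)
      case (Cons x u y v)
      then show ?case using strict(3)
        by (auto simp: Cons_lenlex_iff total_on_def)
    qed simp
  next
    case False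
    then show ?thesis by (auto simp: lenlex_conv)
  qed
  have asym: "(v, u) \<notin> lenlex (r - Id)" if "(u, v) \<in> lenlex (r - Id)" for u v
    using wf that by (meson wf_asym)
  define Q where "Q = {w \<in> reduced_words G S. word_eval G w = g}"
  have "Q \<noteq> {}" using ex_reduced_word[OF assms(1,3,5)] by (auto simp: Q_def)
  with wf obtain w where w: "w \<in> Q" "\<And>v. (v, w) \<in> lenlex (r - Id) \<Longrightarrow> v \<notin> Q"
    by (metis wf_eq_minimal equals0I)
  have least: "shortlex_le r w v" if "v \<in> Q" for v
  proof -
    have "set w \<subseteq> S" "set v \<subseteq> S" using w(1) that by (auto simp: Q_def reduced_words_def)
    then show ?thesis using total[of w v] w(2)[of v] that by (auto simp: shortlex_le_def)
  qed
  have "u = w" if "u \<in> Q" "\<forall>v\<in>Q. shortlex_le r u v" for u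
    using least[OF that(1)] that(2) w(1) asym unfolding shortlex_le_def by metis
  then have "\<exists>!w. w \<in> Q \<and> (\<forall>v\<in>Q. shortlex_le r w v)" using w(1) least by blast
  then show ?thesis unfolding Q_def mem_Collect_eq Ball_def by (simp add: conj_assoc imp_conjL)
qed

end

theory Submission
  imports Defs
begin

text \<open>
  Shortlex representatives are geodesic and closed under prefixes, so they form a tree on \<open>G\<close> rooted
  at the identity. Enumerate \<open>G\<close> so that word length never decreases, and let the \<open>n\<close>-th retraction
  send \<open>g\<close> to its last ancestor among the elements with number at most \<open>n\<close>. These retractions commute,
  each range has one more point than the previous one, and combability makes them uniformly
  Lipschitz. Composition with them yields uniformly bounded commuting projections on the free
  space whose ranks grow by one. The basis vectors are the differences \<open>\<delta>(g) - \<delta>(parent of g)\<close>, and the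
  coefficient functionals are evaluations at the indicators of subtrees, normalised at \<open>p\<close>.
\<close>

section \<open>Lipschitz functions and their functionals\<close>

text \<open>The constant in \<open>Lipschitz_continuous_map\<close> is unrestricted in sign;
  replacing it by \<open>max B 0\<close> gives the nonnegative constants over which
  \<open>Lip_norm\<close> takes its infimum, so that infimum is over a nonempty set.\<close>

lemma Lip0_iff:
  "f \<in> Lip0 m p \<longleftrightarrow>
     (\<exists>L\<ge>0. \<forall>x\<in>mspace m. \<forall>y\<in>mspace m. \<bar>f x - f y\<bar> \<le> L * mdist m x y) \<and>
     f p = 0 \<and> (\<forall>x. x \<notin> mspace m \<longrightarrow> f x = 0)"
proof -
  have "\<exists>L\<ge>0. \<forall>x\<in>mspace m. \<forall>y\<in>mspace m. \<bar>f x - f y\<bar> \<le> L * mdist m x y"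
    if B: "\<forall>x\<in>mspace m. \<forall>y\<in>mspace m. \<bar>f x - f y\<bar> \<le> B * mdist m x y" for B
  proof (intro exI[of _ "max B 0"] conjI ballI)
    fix x y assume "x \<in> mspace m" "y \<in> mspace m"
    with B show "\<bar>f x - f y\<bar> \<le> max B 0 * mdist m x y"
      by (smt (verit) mult_right_mono mdist_nonneg)
  qed simp
  then show ?thesis
    by (auto simp: Lip0_def Lipschitz_continuous_map_def dist_real_def)
qed

lemma Lip0I:
  assumes "\<And>x y. x \<in> mspace m \<Longrightarrow> y \<in> mspace m \<Longrightarrow> \<bar>f x - f y\<bar> \<le> L * mdist m x y"
    and "L \<ge> 0" "f p = 0" "\<And>x. x \<notin> mspace m \<Longrightarrow> f x = 0"
  shows "f \<in> Lip0 m p"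
  unfolding Lip0_iff using assms by blast

lemma Lip_norm_le:
  assumes "L \<ge> 0" "\<And>x y. x \<in> mspace m \<Longrightarrow> y \<in> mspace m \<Longrightarrow> \<bar>f x - f y\<bar> \<le> L * mdist m x y"
  shows "Lip_norm m f \<le> L"
  unfolding Lip_norm_def using assms by (intro cInf_lower bdd_belowI[of _ 0]) auto

lemma Lip_norm_nonneg:
  assumes "f \<in> Lip0 m p"
  shows "Lip_norm m f \<ge> 0"
  unfolding Lip_norm_def using assms by (intro cInf_greatest) (auto simp: Lip0_iff)

text \<open>The infimum is attained: for distinct points every admissible constant is at least the
  difference quotient, hence so is their infimum.\<close>

lemma Lip_norm_bound:
  assumes "f \<in> Lip0 m p" "x \<in> mspace m" "y \<in> mspace m"
  shows "\<bar>f x - f y\<bar> \<le> Lip_norm m f * mdist m x y"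
proof (cases "x = y")
  case False
  then have d: "mdist m x y > 0" using assms by (simp add: less_le)
  have "\<bar>f x - f y\<bar> / mdist m x y \<le> Lip_norm m f"
    unfolding Lip_norm_def using assms d
    by (intro cInf_greatest) (auto simp: Lip0_iff divide_le_eq)
  then show ?thesis using d by (simp add: divide_le_eq)
next
  case True
  then have "mdist m x y = 0" using assms by simp
  then show ?thesis using True by simp
qed

lemma Lip0_zero: "(\<lambda>x. 0) \<in> Lip0 m p"
  by (rule Lip0I[of _ _ 0]) auto

lemma Lip0_scale:
  assumes "f \<in> Lip0 m p"
  shows "(\<lambda>x. c * f x) \<in> Lip0 m p"
proof (rule Lip0I)
  fix x y assume "x \<in> mspace m" "y \<in> mspace m"
  then have "\<bar>c\<bar> * \<bar>f x - f y\<bar> \<le> \<bar>c\<bar> * (Lip_norm m f * mdist m x y)"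
    using assms by (intro mult_left_mono Lip_norm_bound) auto
  then show "\<bar>c * f x - c * f y\<bar> \<le> (\<bar>c\<bar> * Lip_norm m f) * mdist m x y"
    by (simp add: abs_mult mult.assoc flip: right_diff_distrib)
qed (use assms Lip_norm_nonneg[OF assms] in \<open>auto simp: Lip0_iff\<close>)

lemma Lip0_add:
  assumes "f \<in> Lip0 m p" "g \<in> Lip0 m p"
  shows "(\<lambda>x. f x + g x) \<in> Lip0 m p"
proof (rule Lip0I)
  fix x y assume "x \<in> mspace m" "y \<in> mspace m"
  then show "\<bar>(f x + g x) - (f y + g y)\<bar> \<le> (Lip_norm m f + Lip_norm m g) * mdist m x y"
    using Lip_norm_bound[OF assms(1), of x y] Lip_norm_bound[OF assms(2), of x y]
    by (simp add: distrib_right)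
qed (use assms Lip_norm_nonneg[OF assms(1)] Lip_norm_nonneg[OF assms(2)] in \<open>auto simp: Lip0_iff\<close>)

lemma Lip0_sum:
  assumes "finite A" "\<And>i. i \<in> A \<Longrightarrow> h i \<in> Lip0 m p"
  shows "(\<lambda>x. \<Sum>i\<in>A. c i * h i x) \<in> Lip0 m p"
  using assms by (induction A) (auto intro!: Lip0_zero Lip0_add Lip0_scale)

section \<open>Bounded linear functionals on Lipschitz functions and their norm\<close>

lemma Lip0_dual_sum:
  assumes "\<phi> \<in> Lip0_dual m p" "finite A" "\<And>i. i \<in> A \<Longrightarrow> h i \<in> Lip0 m p"
  shows "\<phi> (\<lambda>x. \<Sum>i\<in>A. c i * h i x) = (\<Sum>i\<in>A. c i * \<phi> (h i))"
proof -
  have add: "\<phi> (\<lambda>x. f x + g x) = \<phi> f + \<phi> g" if "f \<in> Lip0 m p" "g \<in> Lip0 m p" for f g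
    using assms(1) that by (simp add: Lip0_dual_def)
  have scale: "\<phi> (\<lambda>x. c * f x) = c * \<phi> f" if "f \<in> Lip0 m p" for f c
    using assms(1) that by (simp add: Lip0_dual_def)
  show ?thesis
    using assms(2,3)
  proof (induction A)
    case empty
    show ?case using scale[OF Lip0_zero, of 0] by simp
  next
    case (insert i A)
    then show ?case
      using add[OF Lip0_scale[of "h i" m p "c i"] Lip0_sum[of A h m p c]] scale by simp
  qed
qed

lemma Lip0_dual_bounded:
  assumes "\<phi> \<in> Lip0_dual m p"
  obtains B where "\<And>f. f \<in> Lip0 m p \<Longrightarrow> \<bar>\<phi> f\<bar> \<le> B * Lip_norm m f"
  using assms unfolding Lip0_dual_def by blast

lemma Lip0_dual_zero: "(\<lambda>f. 0) \<in> Lip0_dual m p"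
  by (auto simp: Lip0_dual_def intro!: exI[of _ 0])

lemma Lip0_dual_add_scale:
  assumes "\<phi> \<in> Lip0_dual m p" "\<psi> \<in> Lip0_dual m p"
  shows "(\<lambda>f. \<phi> f + c * \<psi> f) \<in> Lip0_dual m p"
proof -
  obtain B C where B: "\<And>f. f \<in> Lip0 m p \<Longrightarrow> \<bar>\<phi> f\<bar> \<le> B * Lip_norm m f"
    and C: "\<And>f. f \<in> Lip0 m p \<Longrightarrow> \<bar>\<psi> f\<bar> \<le> C * Lip_norm m f"
    using assms[THEN Lip0_dual_bounded] by metis
  have "\<bar>\<phi> f + c * \<psi> f\<bar> \<le> (B + \<bar>c\<bar> * C) * Lip_norm m f" if "f \<in> Lip0 m p" for f
  proof -
    have "\<bar>\<phi> f + c * \<psi> f\<bar> \<le> \<bar>\<phi> f\<bar> + \<bar>c\<bar> * \<bar>\<psi> f\<bar>" by (metis abs_mult abs_triangle_ineq)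
    also have "\<dots> \<le> B * Lip_norm m f + \<bar>c\<bar> * (C * Lip_norm m f)"
      using that by (intro add_mono B C mult_left_mono) auto
    finally show ?thesis by (simp add: algebra_simps)
  qed
  then have "\<exists>B. \<forall>f\<in>Lip0 m p. \<bar>\<phi> f + c * \<psi> f\<bar> \<le> B * Lip_norm m f" by blast
  then show ?thesis using assms unfolding Lip0_dual_def by (simp add: algebra_simps)
qed

lemma Lip0_dual_diff:
  assumes "\<phi> \<in> Lip0_dual m p" "\<psi> \<in> Lip0_dual m p"
  shows "(\<lambda>f. \<phi> f - \<psi> f) \<in> Lip0_dual m p"
  using Lip0_dual_add_scale[OF assms, of "-1"] by simp

lemma Lip0_dual_lincomb:
  assumes "finite A" "\<And>i. i \<in> A \<Longrightarrow> \<phi> i \<in> Lip0_dual m p"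
  shows "(\<lambda>f. \<Sum>i\<in>A. c i * \<phi> i f) \<in> Lip0_dual m p"
  using assms
proof (induction A)
  case (insert i A)
  then show ?case
    using Lip0_dual_add_scale[of "\<lambda>f. \<Sum>i\<in>A. c i * \<phi> i f" m p "\<phi> i" "c i"]
    by (simp add: add.commute)
qed (simp add: Lip0_dual_zero)

lemma evaluation_in_dual:
  assumes "x \<in> mspace m" "p \<in> mspace m"
  shows "evaluation m p x \<in> Lip0_dual m p"
proof -
  have "\<bar>f x\<bar> \<le> mdist m x p * Lip_norm m f" if "f \<in> Lip0 m p" for f
    using Lip_norm_bound[OF that assms] that by (simp add: Lip0_iff mult.commute)
  then show ?thesis
    using Lip0_add[of _ m p] Lip0_scale[of _ m p]
    by (auto simp: Lip0_dual_def evaluation_def intro!: exI[of _ "mdist m x p"])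
qed

lemma evaluation_span_in_dual:
  assumes "p \<in> mspace m" "\<psi> \<in> evaluation_span m p"
  shows "\<psi> \<in> Lip0_dual m p"
  using assms by (auto simp: evaluation_span_def intro!: Lip0_dual_lincomb evaluation_in_dual)

lemma Lip0_dual_norm_le:
  assumes "\<And>f. f \<in> Lip0 m p \<Longrightarrow> Lip_norm m f \<le> 1 \<Longrightarrow> \<bar>\<phi> f\<bar> \<le> C"
  shows "Lip0_dual_norm m p \<phi> \<le> C"
proof -
  have "Lip_norm m (\<lambda>x. 0) \<le> 1" by (rule Lip_norm_le) auto
  then show ?thesis
    unfolding Lip0_dual_norm_def using assms Lip0_zero[of m p] by (intro cSup_least) auto
qed

text \<open>Boundedness of \<phi> makes the set under \<open>Sup\<close> bounded above, so that the
  supremum is a genuine one.\<close>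

lemma Lip0_dual_norm_bound1:
  assumes "\<phi> \<in> Lip0_dual m p" "f \<in> Lip0 m p" "Lip_norm m f \<le> 1"
  shows "\<bar>\<phi> f\<bar> \<le> Lip0_dual_norm m p \<phi>"
proof -
  obtain B where B: "\<And>f. f \<in> Lip0 m p \<Longrightarrow> \<bar>\<phi> f\<bar> \<le> B * Lip_norm m f"
    using Lip0_dual_bounded[OF assms(1)] by metis
  have "\<bar>\<phi> f\<bar> \<le> \<bar>B\<bar>" if "f \<in> Lip0 m p" "Lip_norm m f \<le> 1" for f
  proof -
    have "B * Lip_norm m f \<le> \<bar>B\<bar> * 1"
      using that Lip_norm_nonneg[OF that(1)] by (intro mult_mono) auto
    then show ?thesis using B[OF that(1)] by simp
  qed
  then show ?thesis
    unfolding Lip0_dual_norm_def using assms by (intro cSup_upper bdd_aboveI[of _ "\<bar>B\<bar>"]) auto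
qed

lemma Lip0_dual_norm_nonneg:
  assumes "\<phi> \<in> Lip0_dual m p"
  shows "Lip0_dual_norm m p \<phi> \<ge> 0"
proof -
  have "Lip_norm m (\<lambda>x. 0) \<le> 1" by (rule Lip_norm_le) auto
  then show ?thesis using Lip0_dual_norm_bound1[OF assms Lip0_zero] by (meson abs_ge_zero order_trans)
qed

text \<open>Rescale f to Lipschitz norm one. If the norm of f is zero, some bound B * 0 already
  forces \<phi> f = 0.\<close>

lemma Lip0_dual_norm_bound:
  assumes "\<phi> \<in> Lip0_dual m p" "f \<in> Lip0 m p"
  shows "\<bar>\<phi> f\<bar> \<le> Lip0_dual_norm m p \<phi> * Lip_norm m f"
proof (cases "Lip_norm m f = 0")
  case True
  then show ?thesis using assms by (fastforce simp: Lip0_dual_def)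
next
  case False
  define t where "t = Lip_norm m f"
  have t: "t > 0" using False Lip_norm_nonneg[OF assms(2)] by (simp add: t_def)
  have "Lip_norm m (\<lambda>x. (1 / t) * f x) \<le> 1"
  proof (rule Lip_norm_le)
    fix x y assume "x \<in> mspace m" "y \<in> mspace m"
    then have "\<bar>f x - f y\<bar> / t \<le> t * mdist m x y / t"
      using Lip_norm_bound[OF assms(2)] t by (intro divide_right_mono) (auto simp: t_def)
    then show "\<bar>(1 / t) * f x - (1 / t) * f y\<bar> \<le> 1 * mdist m x y"
      using t by (simp add: abs_if field_simps split: if_splits)
  qed simp
  then have "\<bar>\<phi> (\<lambda>x. (1 / t) * f x)\<bar> \<le> Lip0_dual_norm m p \<phi>"
    by (intro Lip0_dual_norm_bound1 assms Lip0_scale)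
  moreover have "\<phi> (\<lambda>x. (1 / t) * f x) = (1 / t) * \<phi> f"
    using assms unfolding Lip0_dual_def by blast
  ultimately have "\<bar>(1 / t) * \<phi> f\<bar> \<le> Lip0_dual_norm m p \<phi>" by simp
  then show ?thesis using t by (simp add: abs_mult divide_le_eq t_def)
qed

lemma evaluation_diff_in_free:
  assumes "x \<in> mspace m" "y \<in> mspace m" "p \<in> mspace m"
  shows "(\<lambda>f. evaluation m p x f - evaluation m p y f) \<in> Lipschitz_free m p"
proof -
  let ?e = "\<lambda>f. evaluation m p x f - evaluation m p y f"
  \<comment> \<open>For x = y the set {x, y} has a single element and cannot carry both coefficients
    1 and -1; the difference is then the empty combination.\<close>
  have span: "?e \<in> evaluation_span m p"
  proof (cases "x = y")
    case True
    then show ?thesis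
      unfolding evaluation_span_def by (auto intro!: exI[of _ "{}"])
  next
    case False
    then show ?thesis
      unfolding evaluation_span_def using assms
      by (auto intro!: exI[of _ "{x, y}"] exI[of _ "\<lambda>z. if z = x then 1 else -1"])
  qed
  have "Lip0_dual_norm m p (\<lambda>f. ?e f - ?e f) \<le> 0"
    by (rule Lip0_dual_norm_le) simp
  then have "\<exists>\<psi>\<in>evaluation_span m p. Lip0_dual_norm m p (\<lambda>f. ?e f - \<psi> f) < \<epsilon>" if "\<epsilon> > 0" for \<epsilon>
    using span that by (intro bexI[of _ ?e]) auto
  then show ?thesis
    using evaluation_span_in_dual[OF assms(3) span] by (simp add: Lipschitz_free_def)
qed


section \<open>Bases from commuting retractions\<close>

text \<open>Partial sums are adjoint to composition with \<open>R n\<close>. By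
  \<open>R_comm\<close> each \<open>R n\<close> is idempotent and the ranges are nested; by
  \<open>R_0\<close> the first range is a single point, and by \<open>R_Suc\<close> each later one
  gains exactly one. \<open>R_stop\<close> covers a finite index set. The base point p need not be
  fixed by the retractions, whence the corrections at p below.\<close>

theorem has_Schauder_basis_retractions:
  fixes m :: "'a metric" and R :: "nat \<Rightarrow> 'a \<Rightarrow> 'a"
  assumes p: "p \<in> mspace m"
    and I: "I = UNIV \<or> (\<exists>n. I = {..<n})"
    and R_in: "\<And>n x. x \<in> mspace m \<Longrightarrow> R n x \<in> mspace m"
    and R_lip: "\<And>n x y. x \<in> mspace m \<Longrightarrow> y \<in> mspace m \<Longrightarrow> mdist m (R n x) (R n y) \<le> L * mdist m x y"
    and L: "L \<ge> 0"
    and R_comm: "\<And>n k x. x \<in> mspace m \<Longrightarrow> R n (R k x) = R (min n k) x"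
    and R_0: "\<And>x y. x \<in> mspace m \<Longrightarrow> y \<in> mspace m \<Longrightarrow> R 0 x = R 0 y"
    and R_Suc: "\<And>n. n \<in> I \<Longrightarrow> u n \<in> mspace m - R n ` mspace m \<and>
                  R (Suc n) ` mspace m = insert (u n) (R n ` mspace m)"
    and R_stop: "\<And>n x. n \<notin> I \<Longrightarrow> x \<in> mspace m \<Longrightarrow> R (Suc n) x = R n x"
    and R_id: "\<And>x. x \<in> mspace m \<Longrightarrow> \<forall>\<^sub>F n in sequentially. R n x = x"
  shows "has_Schauder_basis (Lipschitz_free m p) (Lip0_dual_norm m p)"
proof -
  let ?M = "mspace m"
  \<comment> \<open>In the tree, \<open>v i\<close> is the parent of the new point
    \<open>u i\<close>, and \<open>C i\<close> is the subtree rooted at \<open>u i\<close>.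
    Subtracting the constant \<open>indicator (C i) p\<close> puts \<open>h i\<close> into
    \<open>Lip0\<close>, wherever p lies.\<close>
  define v where "v i = R i (u i)" for i
  define e where "e i = (\<lambda>f. evaluation m p (u i) f - evaluation m p (v i) f)" for i
  define C where "C i = {x \<in> ?M. R (Suc i) x \<noteq> R i x}" for i
  define h where "h i x = (if x \<in> ?M then indicator (C i) x - indicator (C i) p else 0 :: real)" for i x
  have u_in: "u i \<in> ?M" if "i \<in> I" for i using R_Suc[OF that] by auto
  have v_in: "v i \<in> ?M" if "i \<in> I" for i using u_in[OF that] R_in by (simp add: v_def)
  have u_fix: "R (Suc i) (u i) = u i" if "i \<in> I" for i
  proof -
    have "u i \<in> R (Suc i) ` ?M" using R_Suc[OF that] by simp
    then show ?thesis using R_comm by auto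
  qed
  have u_neq_v: "u i \<noteq> v i" if "i \<in> I" for i
    using R_Suc[OF that] v_def by (metis DiffE imageI)
  \<comment> \<open>A value of \<open>R (Suc i)\<close> that lies in the range of \<open>R i\<close>
    is fixed by \<open>R i\<close>, so both retractions agree there. On \<open>C i\<close> the value
    must therefore be the only new point.\<close>
  have RC: "R (Suc i) x = u i \<and> R i x = v i" if "i \<in> I" "x \<in> C i" for i x
  proof -
    have x: "x \<in> ?M" "R (Suc i) x \<noteq> R i x" using that by (auto simp: C_def)
    have *: "R i (R (Suc i) x) = R i x" using R_comm x by simp
    have "R (Suc i) x \<notin> R i ` ?M"
    proof
      assume "R (Suc i) x \<in> R i ` ?M"
      then obtain y where y: "y \<in> ?M" "R (Suc i) x = R i y" by auto
      then have "R i (R (Suc i) x) = R (Suc i) x" using R_comm[OF y(1), of i i] by simp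
      then show False using * x by simp
    qed
    moreover have "R (Suc i) x \<in> insert (u i) (R i ` ?M)" using R_Suc[OF that(1)] x(1) by blast
    ultimately have "R (Suc i) x = u i" by simp
    then show ?thesis using * by (simp add: v_def)
  qed
  have e_f: "e i f = f (u i) - f (v i)" if "f \<in> Lip0 m p" for i f
    using that by (simp add: e_def evaluation_def)
  have e_free: "e i \<in> Lipschitz_free m p" if "i \<in> I" for i
    unfolding e_def using evaluation_diff_in_free[OF u_in v_in p] that by simp
  have e_dual: "e i \<in> Lip0_dual m p" if "i \<in> I" for i
    using e_free[OF that] by (simp add: Lipschitz_free_def)
  have h_lip: "h i \<in> Lip0 m p" if i: "i \<in> I" for i
  proof (rule Lip0I)
    define D where "D = mdist m (u i) (v i)"
    have D: "D > 0" using u_neq_v u_in v_in i by (simp add: D_def less_le)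
    \<comment> \<open>Writing the indicator through distances to \<open>v i\<close> shows that it is
      Lipschitz: on \<open>C i\<close> the two distances are D and 0, elsewhere they cancel, and
      each is L-Lipschitz in x.\<close>
    have ind: "indicator (C i) x = (mdist m (R (Suc i) x) (v i) - mdist m (R i x) (v i)) / D"
      if "x \<in> ?M" for x
    proof (cases "x \<in> C i")
      case True
      then show ?thesis using RC[OF i True] D v_in[OF i] by (simp add: D_def)
    next
      case False
      then show ?thesis using that by (simp add: C_def)
    qed
    have lip1: "\<bar>mdist m (R n x) (v i) - mdist m (R n y) (v i)\<bar> \<le> L * mdist m x y"
      if "x \<in> ?M" "y \<in> ?M" for n x y
    proof -
      have "mdist m (R n x) (v i) \<le> mdist m (R n x) (R n y) + mdist m (R n y) (v i)"
        "mdist m (R n y) (v i) \<le> mdist m (R n y) (R n x) + mdist m (R n x) (v i)"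
        using that R_in v_in[OF i] by (auto intro: mdist_triangle)
      then show ?thesis using R_lip[OF that, of n] mdist_commute[of m "R n x" "R n y"] by linarith
    qed
    fix x y assume xy: "x \<in> ?M" "y \<in> ?M"
    have "h i x - h i y = ((mdist m (R (Suc i) x) (v i) - mdist m (R (Suc i) y) (v i))
        - (mdist m (R i x) (v i) - mdist m (R i y) (v i))) / D"
      using xy by (simp add: h_def ind diff_divide_distrib)
    then have "\<bar>h i x - h i y\<bar> = \<bar>(mdist m (R (Suc i) x) (v i) - mdist m (R (Suc i) y) (v i))
        - (mdist m (R i x) (v i) - mdist m (R i y) (v i))\<bar> / D"
      using D by simp
    also have "\<dots> \<le> (2 * L * mdist m x y) / D"
      using lip1[OF xy, of i] lip1[OF xy, of "Suc i"] D by (intro divide_right_mono) auto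
    finally show "\<bar>h i x - h i y\<bar> \<le> (2 * L / mdist m (u i) (v i)) * mdist m x y"
      by (simp add: D_def)
  qed (use L p in \<open>auto simp: h_def\<close>)
  \<comment> \<open>For i < k both \<open>u i\<close> and \<open>v i\<close> are fixed by
    \<open>R k\<close> and \<open>R (Suc k)\<close>, so neither is in \<open>C k\<close>. For k < i
    these two maps take the same values at \<open>u i\<close> and at \<open>v i = R i (u i)\<close>,
    so the indicators cancel. Only i = k leaves \<open>u i\<close> inside and \<open>v i\<close>
    outside.\<close>
  have biorth: "e i (h k) = (if i = k then 1 else 0)" if ik: "i \<in> I" "k \<in> I" for i k
  proof -
    have "e i (h k) = indicator (C k) (u i) - indicator (C k) (v i)"
      using e_f[OF h_lip[OF ik(2)]] u_in v_in ik by (simp add: h_def)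
    moreover
    have Rv: "R n (v i) = R (min n i) (u i)" for n
      unfolding v_def by (rule R_comm[OF u_in[OF ik(1)]])
    note uv = u_in[OF ik(1)] v_in[OF ik(1)] u_fix[OF ik(1)] u_neq_v[OF ik(1)]
    consider "i = k" | "i < k" | "k < i" by linarith
    then have "indicator (C k) (u i) - indicator (C k) (v i) = (if i = k then 1 else 0 :: real)"
    proof cases
      case 1
      moreover have "R i (u i) = v i" by (simp add: v_def)
      moreover have "R i (v i) = v i" "R (Suc i) (v i) = v i" using Rv by (simp_all add: v_def)
      ultimately show ?thesis using uv by (simp add: C_def indicator_def)
    next
      case 2
      have Ru: "R n (u i) = u i" if "n > i" for n
      proof -
        have "min n (Suc i) = Suc i" using that by simp
        then show ?thesis using R_comm[OF uv(1), of n "Suc i"] uv(3) by simp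
      qed
      have "min k i = i" "min (Suc k) i = i" using 2 by simp_all
      then have "u i \<notin> C k" "v i \<notin> C k" using 2 Ru[of k] Ru[of "Suc k"] Rv by (simp_all add: C_def)
      then show ?thesis using 2 by simp
    next
      case 3
      then have "min k i = k" "min (Suc k) i = Suc k" by simp_all
      then have "u i \<in> C k \<longleftrightarrow> v i \<in> C k" using uv Rv[of k] Rv[of "Suc k"] by (simp add: C_def)
      then show ?thesis using 3 by (simp add: indicator_def)
    qed
    ultimately show ?thesis by simp
  qed
  define T where "T n f = (\<lambda>x. \<Sum>i\<in>I \<inter> {..<n}. e i f * h i x)" for n and f :: "'a \<Rightarrow> real"
  \<comment> \<open>The sum telescopes: passing from n to n + 1 moves exactly the points of
    \<open>C n\<close>, from \<open>v n\<close> to \<open>u n\<close>, and changes f there by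
    \<open>e n f\<close>. It starts at 0 because \<open>R 0\<close> is constant.\<close>
  have T_eq: "T n f x = f (R n x) - f (R n p)" if "f \<in> Lip0 m p" "x \<in> ?M" for n f x
  proof (induction n)
    case 0
    show ?case using R_0[OF that(2) p] by (simp add: T_def)
  next
    case (Suc n)
    show ?case
    proof (cases "n \<in> I")
      case False
      then have "I \<inter> {..<Suc n} = I \<inter> {..<n}" by (auto simp: less_Suc_eq)
      then show ?thesis using Suc R_stop[OF False] that p by (simp add: T_def)
    next
      case True
      then have "I \<inter> {..<Suc n} = insert n (I \<inter> {..<n})" by (auto simp: less_Suc_eq)
      then have "T (Suc n) f x = T n f x + e n f * h n x" by (simp add: T_def)
      moreover have "f (R (Suc n) y) = f (R n y) + e n f * indicator (C n) y" if "y \<in> ?M" for y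
        using that RC[OF True, of y] e_f[OF \<open>f \<in> Lip0 m p\<close>] by (cases "y \<in> C n") (auto simp: C_def)
      ultimately show ?thesis using Suc that p by (simp add: h_def algebra_simps)
    qed
  qed
  have T_lip: "T n f \<in> Lip0 m p" for n f
    unfolding T_def by (rule Lip0_sum) (use h_lip in auto)
  have T_norm: "Lip_norm m (T n f) \<le> L" if f: "f \<in> Lip0 m p" "Lip_norm m f \<le> 1" for n f
  proof (rule Lip_norm_le[OF L])
    fix x y assume xy: "x \<in> ?M" "y \<in> ?M"
    have "\<bar>T n f x - T n f y\<bar> = \<bar>f (R n x) - f (R n y)\<bar>" using T_eq f xy by simp
    also have "\<dots> \<le> Lip_norm m f * mdist m (R n x) (R n y)" using f xy R_in by (intro Lip_norm_bound)
    also have "\<dots> \<le> 1 * (L * mdist m x y)"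
      using f xy R_lip Lip_norm_nonneg[OF f(1)] by (intro mult_mono) auto
    finally show "\<bar>T n f x - T n f y\<bar> \<le> L * mdist m x y" by simp
  qed
  \<comment> \<open>The candidate expansion of \<phi> has partial sums \<phi> composed with
    \<open>T n\<close>, so the bound L on \<open>T n\<close> makes the partial-sum operators
    uniformly bounded.\<close>
  have partial: "(\<Sum>i\<in>I \<inter> {..<n}. \<phi> (h i) * e i f) = \<phi> (T n f)"
    if "\<phi> \<in> Lip0_dual m p" for \<phi> f n
    unfolding T_def using Lip0_dual_sum[OF that, of "I \<inter> {..<n}" h "\<lambda>i. e i f"] h_lip
    by (simp add: mult.commute)
  \<comment> \<open>Only finitely many points occur in \<psi>; once \<open>R n\<close> fixes them
    and p, equality holds for all f at once, as an estimate in the dual norm requires.\<close>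
  have span_fix: "\<forall>\<^sub>F n in sequentially. \<forall>f\<in>Lip0 m p. \<psi> (T n f) = \<psi> f"
    if \<psi>: "\<psi> \<in> evaluation_span m p" for \<psi>
  proof -
    obtain A c where A: "finite A" "A \<subseteq> ?M" "\<psi> = (\<lambda>f. \<Sum>x\<in>A. c x * evaluation m p x f)"
      using \<psi> unfolding evaluation_span_def by blast
    have "\<forall>\<^sub>F n in sequentially. \<forall>x\<in>insert p A. R n x = x"
      using A p R_id by (intro eventually_ball_finite) auto
    then show ?thesis
    proof eventually_elim
      case (elim n)
      have "T n f x = f x" if "f \<in> Lip0 m p" "x \<in> A" for f x
        using T_eq[of f x n] that A(2) elim p by (auto simp: Lip0_iff)
      then show ?case using T_lip by (auto simp: A(3) evaluation_def intro!: sum.cong)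
    qed
  qed
  have conv: "(\<lambda>n. Lip0_dual_norm m p (\<lambda>f. \<phi> f - (\<Sum>i\<in>I \<inter> {..<n}. \<phi> (h i) * e i f))) \<longlonglongrightarrow> 0"
    if \<phi>: "\<phi> \<in> Lipschitz_free m p" for \<phi>
  proof (rule tendstoI)
    fix \<epsilon> :: real assume \<epsilon>: "\<epsilon> > 0"
    \<comment> \<open>The error will be at most \<eta> from \<theta> f plus \<eta> * L from \<theta>
      (T n f), so this choice makes it \<epsilon> / 2, strictly below \<epsilon>.\<close>
    define \<eta> where "\<eta> = \<epsilon> / (2 * (L + 1))"
    have \<eta>: "\<eta> > 0" using \<epsilon> L by (simp add: \<eta>_def)
    have dual: "\<phi> \<in> Lip0_dual m p" using \<phi> by (simp add: Lipschitz_free_def)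
    obtain \<psi> where \<psi>: "\<psi> \<in> evaluation_span m p" "Lip0_dual_norm m p (\<lambda>f. \<phi> f - \<psi> f) < \<eta>"
      using \<phi> \<eta> unfolding Lipschitz_free_def by blast
    define \<theta> where "\<theta> = (\<lambda>f. \<phi> f - \<psi> f)"
    have \<theta>: "\<theta> \<in> Lip0_dual m p"
      unfolding \<theta>_def by (rule Lip0_dual_diff[OF dual evaluation_span_in_dual[OF p \<psi>(1)]])
    show "\<forall>\<^sub>F n in sequentially. dist (Lip0_dual_norm m p
            (\<lambda>f. \<phi> f - (\<Sum>i\<in>I \<inter> {..<n}. \<phi> (h i) * e i f))) 0 < \<epsilon>"
      using span_fix[OF \<psi>(1)]
    proof eventually_elim
      case (elim n)
      have "Lip0_dual_norm m p (\<lambda>f. \<phi> f - \<phi> (T n f)) \<le> \<eta> * (L + 1)"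
      proof (rule Lip0_dual_norm_le)
        fix f assume f: "f \<in> Lip0 m p" "Lip_norm m f \<le> 1"
        have "\<bar>\<theta> f\<bar> \<le> \<eta>"
          using Lip0_dual_norm_bound1[OF \<theta> f] \<psi>(2) by (simp add: \<theta>_def)
        moreover have "\<bar>\<theta> (T n f)\<bar> \<le> Lip0_dual_norm m p \<theta> * Lip_norm m (T n f)"
          by (rule Lip0_dual_norm_bound[OF \<theta> T_lip])
        moreover have "Lip0_dual_norm m p \<theta> * Lip_norm m (T n f) \<le> \<eta> * L"
          using \<psi>(2) T_norm[OF f] \<eta> Lip_norm_nonneg[OF T_lip]
          by (intro mult_mono) (auto simp: \<theta>_def)
        \<comment> \<open>The approximant \<psi> drops out because it is invariant under
          \<open>T n\<close>.\<close>
        moreover have "\<phi> f - \<phi> (T n f) = \<theta> f - \<theta> (T n f)"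
          using elim f by (simp add: \<theta>_def)
        ultimately show "\<bar>\<phi> f - \<phi> (T n f)\<bar> \<le> \<eta> * (L + 1)" by (simp add: distrib_left)
      qed
      moreover have "\<eta> * (L + 1) = \<epsilon> / 2" using L by (simp add: \<eta>_def field_simps)
      moreover have "0 \<le> Lip0_dual_norm m p (\<lambda>f. \<phi> f - \<phi> (T n f))"
        unfolding partial[OF dual, symmetric]
        using dual e_dual by (intro Lip0_dual_norm_nonneg Lip0_dual_diff Lip0_dual_lincomb) auto
      ultimately show ?case
        using \<epsilon> by (simp add: partial[OF dual])
    qed
  qed
  have uniq: "a = (\<lambda>i. if i \<in> I then \<phi> (h i) else 0)"
    if \<phi>: "\<phi> \<in> Lipschitz_free m p" and a: "\<forall>i. i \<notin> I \<longrightarrow> a i = 0"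
      "(\<lambda>n. Lip0_dual_norm m p (\<lambda>f. \<phi> f - (\<Sum>i\<in>I \<inter> {..<n}. a i * e i f))) \<longlonglongrightarrow> 0" for \<phi> a
  proof
    fix k
    show "a k = (if k \<in> I then \<phi> (h k) else 0)"
    proof (cases "k \<in> I")
      case True
      define N where "N n = Lip0_dual_norm m p (\<lambda>f. \<phi> f - (\<Sum>i\<in>I \<inter> {..<n}. a i * e i f))" for n
      \<comment> \<open>Testing the remainder on \<open>h k\<close> isolates the k-th coefficient by
        biorthogonality as soon as n > k; the remainder tends to zero, so the coefficient is
        forced.\<close>
      have "\<bar>\<phi> (h k) - a k\<bar> \<le> N n * Lip_norm m (h k)" if "n > k" for n
      proof -
        have "(\<lambda>f. \<phi> f - (\<Sum>i\<in>I \<inter> {..<n}. a i * e i f)) \<in> Lip0_dual m p"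
          using \<phi> e_dual by (intro Lip0_dual_diff Lip0_dual_lincomb) (auto simp: Lipschitz_free_def)
        note Lip0_dual_norm_bound[OF this h_lip[OF True]]
        moreover have "(\<Sum>i\<in>I \<inter> {..<n}. a i * e i (h k)) = (\<Sum>i\<in>I \<inter> {..<n}. if i = k then a k else 0)"
          using True by (intro sum.cong) (auto simp: biorth)
        ultimately show ?thesis using True that by (simp add: N_def)
      qed
      then have "\<forall>\<^sub>F n in sequentially. \<bar>\<phi> (h k) - a k\<bar> \<le> N n * Lip_norm m (h k)"
        by (rule eventually_mono[OF eventually_gt_at_top])
      moreover have "(\<lambda>n. N n * Lip_norm m (h k)) \<longlonglongrightarrow> 0"
        using tendsto_mult_right[OF a(2), of "Lip_norm m (h k)"] by (simp add: N_def)
      ultimately have "\<bar>\<phi> (h k) - a k\<bar> \<le> 0"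
        by (intro tendsto_lowerbound[of "\<lambda>n. N n * Lip_norm m (h k)"]) auto
      then show ?thesis using True by simp
    qed (use a in simp)
  qed
  have "\<exists>!a. (\<forall>i. i \<notin> I \<longrightarrow> a i = 0) \<and>
      (\<lambda>n. Lip0_dual_norm m p (\<lambda>f. \<phi> f - (\<Sum>i\<in>I \<inter> {..<n}. a i * e i f))) \<longlonglongrightarrow> 0"
    if "\<phi> \<in> Lipschitz_free m p" for \<phi>
  proof (rule ex1I[of _ "\<lambda>i. if i \<in> I then \<phi> (h i) else 0"])
    have "(\<Sum>i\<in>I \<inter> {..<n}. (if i \<in> I then \<phi> (h i) else 0) * e i f) = (\<Sum>i\<in>I \<inter> {..<n}. \<phi> (h i) * e i f)"
      for n f by (intro sum.cong) auto
    then show "(\<forall>i. i \<notin> I \<longrightarrow> (if i \<in> I then \<phi> (h i) else 0) = 0) \<and>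
      (\<lambda>n. Lip0_dual_norm m p (\<lambda>f. \<phi> f - (\<Sum>i\<in>I \<inter> {..<n}. (if i \<in> I then \<phi> (h i) else 0) * e i f)))
        \<longlonglongrightarrow> 0"
      using conv[OF that] by simp
  qed (use uniq[OF that] in blast)
  then have "Schauder_basis (Lipschitz_free m p) (Lip0_dual_norm m p) I e"
    unfolding Schauder_basis_def using I e_free by blast
  then show ?thesis unfolding has_Schauder_basis_def by blast
qed


section \<open>Enumerations\<close>

text \<open>Order A by \<open>len\<close>, breaking ties by an injective code into the naturals, and
  let the position of b be its number of predecessors. Finite layers make this number finite, and
  counting leaves no gaps, whether A is finite or infinite.\<close>

lemma ex_graded_enumeration:
  fixes len :: "'a \<Rightarrow> nat"
  assumes fin: "\<And>n. finite {a \<in> A. len a = n}" and cnt: "countable A"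
  obtains pos :: "'a \<Rightarrow> nat"
  where "inj_on pos A" "\<And>a b. a \<in> A \<Longrightarrow> b \<in> A \<Longrightarrow> len a < len b \<Longrightarrow> pos a < pos b"
    "\<And>a k. a \<in> A \<Longrightarrow> k \<le> pos a \<Longrightarrow> k \<in> pos ` A"
proof -
  define c where "c = to_nat_on A"
  have c: "inj_on c A" unfolding c_def by (rule inj_on_to_nat_on[OF cnt])
  define lt where "lt a b \<longleftrightarrow> len a < len b \<or> len a = len b \<and> c a < c b" for a b
  define P where "P b = {a \<in> A. lt a b}" for b
  define pos where "pos b = card (P b)" for b
  have fin_P: "finite (P b)" for b
  proof (rule finite_subset)
    show "P b \<subseteq> (\<Union>n\<le>len b. {a \<in> A. len a = n})" by (auto simp: P_def lt_def)
  qed (use fin in auto)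
  have mono: "pos a < pos b" if "a \<in> A" "lt a b" for a b
    unfolding pos_def using that fin_P[of b]
    by (intro psubset_card_mono) (auto simp: P_def lt_def)
  have total: "lt a b \<or> lt b a" if "a \<in> A" "b \<in> A" "a \<noteq> b" for a b
    using that inj_onD[OF c, of a b] by (auto simp: lt_def) (meson linorder_neqE_nat)
  have inj: "inj_on pos A"
    using mono total by (metis inj_onI less_irrefl)
  have pred: "\<exists>a\<in>A. Suc (pos a) = pos b" if "b \<in> A" "pos b > 0" for b
  proof -
    have "P b \<noteq> {}" using that by (auto simp: pos_def)
    then have "Max (pos ` P b) \<in> pos ` P b" using fin_P by (intro Max_in) auto
    then obtain a where a: "a \<in> P b" "pos a = Max (pos ` P b)" by auto
    \<comment> \<open>As a has the largest position among the predecessors of b, no predecessor of b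
      lies above a; so b has exactly one predecessor more than a.\<close>
    have "P b = insert a (P a)"
    proof
      show "insert a (P a) \<subseteq> P b" using a(1) by (auto simp: P_def lt_def)
      show "P b \<subseteq> insert a (P a)"
      proof
        fix d assume d: "d \<in> P b"
        then have "pos d \<le> pos a" unfolding a(2) using fin_P by (intro Max_ge) auto
        then have "\<not> lt a d" using mono[of a d] a(1) by (auto simp: P_def)
        then show "d \<in> insert a (P a)" using total[of a d] d a(1) by (auto simp: P_def)
      qed
    qed
    moreover have "a \<notin> P a" by (simp add: P_def lt_def)
    ultimately have "pos b = Suc (pos a)" using fin_P[of a] by (simp add: pos_def)
    then show ?thesis using a(1) by (auto simp: P_def)
  qed
  have "k \<in> pos ` A" if "b \<in> A" "k \<le> pos b" for b k
    using that(2)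
  proof (induction k rule: inc_induct)
    case base
    show ?case using that(1) by simp
  next
    case (step n)
    then obtain d where "d \<in> A" "pos d = Suc n" by auto
    then show ?case using pred[of d] by force
  qed
  then show ?thesis using that[OF inj] mono by (simp add: lt_def)
qed


section \<open>Prefixes of shortlex representatives\<close>

locale shortlex_group =
  fixes G :: "('a, 'b) monoid_scheme" and S :: "'a set" and r :: "('a \<times> 'a) set"
  assumes group: "group G"
    and finite_S: "finite S"
    and generating: "symmetric_generating_set G S"
    and order: "linear_order_on S r"
begin

sublocale group G by (rule group)

abbreviation d :: "'a \<Rightarrow> 'a \<Rightarrow> nat" where "d \<equiv> word_dist G S"
abbreviation ev :: "'a list \<Rightarrow> 'a" where "ev \<equiv> word_eval G"
abbreviation rep :: "'a \<Rightarrow> 'a list" where "rep \<equiv> shortlex_rep G S r"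
abbreviation len :: "'a \<Rightarrow> nat" where "len g \<equiv> d g \<one>\<^bsub>G\<^esub>"

text \<open>The ancestor of g at depth i in the tree of shortlex words; beyond the length of the
  word, \<open>take\<close> leaves g itself.\<close>

definition pre :: "nat \<Rightarrow> 'a \<Rightarrow> 'a" where
  "pre i g = ev (take i (rep g))"

section \<open>Evaluation of words and geodesics\<close>

lemma S_carrier: "set w \<subseteq> S \<Longrightarrow> set w \<subseteq> carrier G"
  using generating by (auto simp: symmetric_generating_set_def)

lemma ev_closed: "set w \<subseteq> S \<Longrightarrow> ev w \<in> carrier G"
  by (intro word_eval_closed group S_carrier)

lemma ev_append: "set u \<subseteq> S \<Longrightarrow> set v \<subseteq> S \<Longrightarrow> ev (u @ v) = ev u \<otimes>\<^bsub>G\<^esub> ev v"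
  by (intro word_eval_append group S_carrier)

lemma ev_Nil: "ev [] = \<one>\<^bsub>G\<^esub>"
  by (simp add: word_eval_def)

lemma len_ev_le: "set w \<subseteq> S \<Longrightarrow> len (ev w) \<le> length w"
  by (rule word_dist_le) (simp_all add: ev_closed)

lemma d_sym: "g \<in> carrier G \<Longrightarrow> h \<in> carrier G \<Longrightarrow> d g h = d h g"
  by (rule word_dist_commute[OF group generating])

lemma d_self [simp]: "d g g = 0"
  by (simp add: word_dist_def)

lemma d_triangle:
  "x \<in> carrier G \<Longrightarrow> y \<in> carrier G \<Longrightarrow> z \<in> carrier G \<Longrightarrow> d x z \<le> d x y + d y z"
  by (rule word_dist_triangle[OF group generating])

lemma rep_props:
  assumes "g \<in> carrier G"
  shows "rep g \<in> reduced_words G S" "ev (rep g) = g"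
    "\<And>v. v \<in> reduced_words G S \<Longrightarrow> ev v = g \<Longrightarrow> shortlex_le r (rep g) v"
  using theI'[OF ex1_shortlex_rep[OF group finite_S generating order assms]]
  unfolding shortlex_rep_def by blast+

lemma rep_in: "g \<in> carrier G \<Longrightarrow> set (rep g) \<subseteq> S"
  using rep_props(1) by (simp add: reduced_words_def)

text \<open>Deleting a cancelling pair of letters would spell the same element with two letters
  fewer. Since \<open>rep\<close> is minimal among reduced words only, this is what admits geodesic
  words to the comparison.\<close>

lemma geodesic_reduced:
  assumes w: "set w \<subseteq> S" "length w \<le> len (ev w)"
  shows "w \<in> reduced_words G S"
proof -
  have "w ! Suc i \<noteq> inv\<^bsub>G\<^esub> (w ! i)" if i: "Suc i < length w" for i
  proof
    assume eq: "w ! Suc i = inv\<^bsub>G\<^esub> (w ! i)"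
    define u v where "u = take i w" and "v = drop (Suc (Suc i)) w"
    have split: "w = u @ [w ! i, w ! Suc i] @ v"
      unfolding u_def v_def using i
      by (metis Cons_nth_drop_Suc Suc_lessD append_Cons append_Nil append_take_drop_id)
    have uv: "set u \<subseteq> S" "set v \<subseteq> S" and s: "w ! i \<in> S" "w ! Suc i \<in> S"
      using i w(1) by (auto simp: u_def v_def dest: in_set_takeD in_set_dropD)
    have "ev [w ! i, w ! Suc i] = \<one>\<^bsub>G\<^esub>"
      using S_carrier[of "[w ! i]"] s eq by (simp add: word_eval_def)
    then have "ev ([w ! i, w ! Suc i] @ v) = ev v"
      using uv s ev_append[of "[w ! i, w ! Suc i]" v] ev_closed[of v] by simp
    moreover have "ev w = ev u \<otimes>\<^bsub>G\<^esub> ev ([w ! i, w ! Suc i] @ v)"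
      using uv s by (subst split, intro ev_append) auto
    ultimately have "ev w = ev (u @ v)"
      using uv by (simp add: ev_append)
    then have "len (ev w) \<le> length (u @ v)" using len_ev_le[of "u @ v"] uv by simp
    then show False using w(2) i by (simp add: u_def v_def)
  qed
  then show ?thesis using w(1) by (simp add: reduced_words_def)
qed

lemma shortlex_le_length: "shortlex_le r u v \<Longrightarrow> length u \<le> length v"
  by (auto simp: shortlex_le_def dest: lenlex_length)

lemma length_rep:
  assumes "g \<in> carrier G"
  shows "length (rep g) = len g"
proof -
  obtain w where w: "length w = len g" "set w \<subseteq> S" "g = \<one>\<^bsub>G\<^esub> \<otimes>\<^bsub>G\<^esub> ev w"
    using word_dist_witness[OF group generating assms one_closed] by blast
  then have "ev w = g" using ev_closed by simp
  then have "length (rep g) \<le> len g"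
    using rep_props(3)[OF assms] geodesic_reduced[of w] w shortlex_le_length by fastforce
  then show ?thesis
    using len_ev_le[OF rep_in[OF assms]] rep_props(2)[OF assms] by simp
qed

text \<open>If the prefix u had a smaller representative u', then replacing u by u' in the whole
  word would give a smaller word for g, against the minimality of u @ v.\<close>

lemma rep_ev_take:
  assumes g: "g \<in> carrier G"
  shows "rep (ev (take i (rep g))) = take i (rep g)"
proof -
  define u v where "u = take i (rep g)" and "v = drop i (rep g)"
  have uv: "rep g = u @ v" by (simp add: u_def v_def)
  then have in_S: "set u \<subseteq> S" "set v \<subseteq> S" using rep_in[OF g] by simp_all
  define u' where "u' = rep (ev u)"
  have u': "set u' \<subseteq> S" "ev u' = ev u"
    using rep_in rep_props(2) ev_closed in_S by (auto simp: u'_def)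
  have red: "u \<in> reduced_words G S"
    using rep_props(1)[OF g] by (auto simp: reduced_words_def u_def dest: in_set_takeD)
  have le: "shortlex_le r u' u"
    unfolding u'_def using rep_props(3)[of "ev u" u] ev_closed in_S red by simp
  have eval: "ev (u' @ v) = g"
    using rep_props(2)[OF g] u' in_S by (simp add: uv ev_append)
  have "length (u @ v) = len g" using length_rep[OF g] uv by simp
  \<comment> \<open>Minimality of u' gives that it is no longer than u; were it shorter, u' @ v
    would spell g in fewer than \<open>len g\<close> letters. Equality of lengths makes u' @ v
    geodesic and hence reduced.\<close>
  then have len: "length u' = length u"
    using len_ev_le[of "u' @ v"] eval u' in_S shortlex_le_length[OF le] by simp
  have "u' @ v \<in> reduced_words G S"
    using geodesic_reduced[of "u' @ v"] eval u' in_S len \<open>length (u @ v) = len g\<close> by simp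
  then have le': "shortlex_le r (u @ v) (u' @ v)"
    using rep_props(3)[OF g] eval uv by simp
  have "asym (r - Id)"
    using order by (auto simp: order_on_defs antisym_def intro!: asymI)
  then have asym: "asym (lenlex (r - Id))" by (rule asym_lenlex)
  have "u' = u"
  proof (rule ccontr)
    assume neq: "u' \<noteq> u"
    then have "(u' @ v, u @ v) \<in> lenlex (r - Id)"
      using le lenlex_append1[of u' u "r - Id" v v] by (simp add: shortlex_le_def)
    moreover have "(u @ v, u' @ v) \<in> lenlex (r - Id)"
      using le' neq by (simp add: shortlex_le_def)
    ultimately show False using asym by (meson asymD)
  qed
  then show ?thesis by (simp add: u'_def u_def)
qed

section \<open>Truncation along shortlex paths\<close>

lemma rep_pre: "g \<in> carrier G \<Longrightarrow> rep (pre i g) = take i (rep g)"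
  unfolding pre_def by (rule rep_ev_take)

lemma pre_closed: "g \<in> carrier G \<Longrightarrow> pre i g \<in> carrier G"
  unfolding pre_def by (meson ev_closed order_trans rep_in set_take_subset)

lemma len_pre: "g \<in> carrier G \<Longrightarrow> len (pre i g) = min i (len g)"
  using length_rep[OF pre_closed, of g i] length_rep[of g] by (simp add: rep_pre min.commute)

lemma pre_pre: "g \<in> carrier G \<Longrightarrow> pre i (pre j g) = pre (min i j) g"
  by (simp add: pre_def[of i] rep_pre) (simp add: pre_def min.commute)

lemma pre_all: "g \<in> carrier G \<Longrightarrow> len g \<le> i \<Longrightarrow> pre i g = g"
  by (simp add: pre_def length_rep rep_props(2))

lemma pre_0: "pre 0 g = \<one>\<^bsub>G\<^esub>"
  by (simp add: pre_def ev_Nil)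

lemma d_pre_Suc:
  assumes g: "g \<in> carrier G"
  shows "d (pre (Suc i) g) (pre i g) \<le> 1"
proof -
  define w where "w = take 1 (drop i (rep g))"
  have split: "take (Suc i) (rep g) = take i (rep g) @ w"
    using take_add[of i 1 "rep g"] by (simp add: w_def)
  have "set (take (Suc i) (rep g)) \<subseteq> S" using rep_in[OF g] by (meson order_trans set_take_subset)
  then have "set (take i (rep g)) \<subseteq> S" "set w \<subseteq> S" by (simp_all add: split)
  then have "d (pre (Suc i) g) (pre i g) \<le> length w"
    by (intro word_dist_le) (simp_all add: pre_def split ev_append)
  also have "\<dots> \<le> 1" by (simp add: w_def)
  finally show ?thesis .
qed

text \<open>Follow a shortest word from y to x letter by letter and add up the bounds for the single
  steps by the triangle inequality.\<close>

lemma lipschitz_of_adjacent: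
  assumes f: "\<And>x. x \<in> carrier G \<Longrightarrow> f x \<in> carrier G"
    and adj: "\<And>x y. x \<in> carrier G \<Longrightarrow> y \<in> carrier G \<Longrightarrow> d x y = 1 \<Longrightarrow> real (d (f x) (f y)) \<le> C"
    and C: "C \<ge> 0" and xy: "x \<in> carrier G" "y \<in> carrier G"
  shows "real (d (f x) (f y)) \<le> C * real (d x y)"
proof -
  have *: "real (d (f (h \<otimes>\<^bsub>G\<^esub> ev w)) (f h)) \<le> C * real (length w)"
    if "set w \<subseteq> S" "h \<in> carrier G" for w h
    using that
  proof (induction w arbitrary: h)
    case Nil
    then show ?case by (simp add: ev_Nil)
  next
    case (Cons s w)
    then have s: "s \<in> carrier G" using S_carrier[of "[s]"] by simp
    then have hs: "h \<otimes>\<^bsub>G\<^esub> s \<in> carrier G" using Cons.prems by simp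
    have ev_w: "ev w \<in> carrier G" using ev_closed Cons.prems by simp
    have eq: "h \<otimes>\<^bsub>G\<^esub> ev (s # w) = (h \<otimes>\<^bsub>G\<^esub> s) \<otimes>\<^bsub>G\<^esub> ev w"
      using Cons.prems s ev_w by (simp add: word_eval_def m_assoc)
    have "d (h \<otimes>\<^bsub>G\<^esub> s) h \<le> length [s]"
      using Cons.prems s by (intro word_dist_le) (auto simp: word_eval_def)
    \<comment> \<open>A generator may be the identity element; such a letter does not move h and
      contributes distance 0.\<close>
    then consider "d (h \<otimes>\<^bsub>G\<^esub> s) h = 1" | "h \<otimes>\<^bsub>G\<^esub> s = h"
      using word_dist_eq_0_iff[OF group generating hs Cons.prems(2)] by fastforce
    then have step: "real (d (f (h \<otimes>\<^bsub>G\<^esub> s)) (f h)) \<le> C"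
    proof cases
      case 1
      then show ?thesis using adj hs Cons.prems by blast
    qed (use C in simp)
    have "d (f (h \<otimes>\<^bsub>G\<^esub> ev (s # w))) (f h)
        \<le> d (f ((h \<otimes>\<^bsub>G\<^esub> s) \<otimes>\<^bsub>G\<^esub> ev w)) (f (h \<otimes>\<^bsub>G\<^esub> s)) + d (f (h \<otimes>\<^bsub>G\<^esub> s)) (f h)"
      unfolding eq using hs ev_w Cons.prems by (intro d_triangle f) auto
    then show ?case using Cons.IH[OF _ hs] Cons.prems step by (simp add: algebra_simps)
  qed
  obtain w where "length w = d x y" "set w \<subseteq> S" "x = y \<otimes>\<^bsub>G\<^esub> ev w"
    using word_dist_witness[OF group generating xy] by blast
  then show ?thesis using *[of w y] xy by simp
qed


section \<open>Retractions along shortlex representatives\<close>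

lemma ex_position:
  obtains pos :: "'a \<Rightarrow> nat"
  where "inj_on pos (carrier G)"
    "\<And>a b. a \<in> carrier G \<Longrightarrow> b \<in> carrier G \<Longrightarrow> len a < len b \<Longrightarrow> pos a < pos b"
    "\<And>a k. a \<in> carrier G \<Longrightarrow> k \<le> pos a \<Longrightarrow> k \<in> pos ` carrier G"
proof (rule ex_graded_enumeration[where A = "carrier G" and len = len])
  fix n
  have "{g \<in> carrier G. len g = n} \<subseteq> ev ` {w. set w \<subseteq> S \<and> length w = n}"
    using rep_in rep_props(2) length_rep by (force simp: image_iff)
  then show "finite {g \<in> carrier G. len g = n}"
    by (rule finite_subset[OF _ finite_imageI[OF finite_lists_length_eq[OF finite_S]]])
next
  have "carrier G \<subseteq> ev ` lists S"
    using rep_in rep_props(2) by (force simp: image_iff)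
  then show "countable (carrier G)"
    using finite_S by (meson countable_finite countable_image countable_lists countable_subset)
qed (use that in blast)

context
  fixes pos :: "'a \<Rightarrow> nat"
  assumes inj: "inj_on pos (carrier G)"
    and pos_mono: "\<And>a b. a \<in> carrier G \<Longrightarrow> b \<in> carrier G \<Longrightarrow> len a < len b \<Longrightarrow> pos a < pos b"
    and pos_down: "\<And>a k. a \<in> carrier G \<Longrightarrow> k \<le> pos a \<Longrightarrow> k \<in> pos ` carrier G"
begin

text \<open>The depth of the last ancestor of g whose position is at most n. The identity has
  position 0, so depth 0 always qualifies and \<open>Max\<close> is taken over a nonempty
  set.\<close>

definition cut :: "nat \<Rightarrow> 'a \<Rightarrow> nat" where
  "cut n g = Max {i. i \<le> len g \<and> pos (pre i g) \<le> n}"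

definition retr :: "nat \<Rightarrow> 'a \<Rightarrow> 'a" where
  "retr n g = pre (cut n g) g"

lemma pos_pre_mono:
  assumes "g \<in> carrier G" "i \<le> j" "j \<le> len g"
  shows "pos (pre i g) \<le> pos (pre j g)"
proof (cases "i = j")
  case False
  then have "pos (pre i g) < pos (pre j g)"
    using assms by (intro pos_mono) (auto simp: pre_closed len_pre)
  then show ?thesis by simp
qed simp

lemma pos_one: "pos \<one>\<^bsub>G\<^esub> = 0"
proof -
  obtain a where a: "a \<in> carrier G" "pos a = 0"
    using pos_down[OF one_closed, of 0] by (metis imageE le0)
  have "len a = len \<one>\<^bsub>G\<^esub>"
    using pos_mono[OF one_closed a(1)] a(2) by fastforce
  then show ?thesis
    using a word_dist_eq_0_iff[OF group generating a(1) one_closed] by simp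
qed

text \<open>Positions do not decrease along a path from the identity, so the admissible depths form
  an initial segment and the maximum determines all of them.\<close>

lemma cut_props:
  assumes "g \<in> carrier G"
  shows cut_le: "cut n g \<le> len g"
    and le_cut_iff: "\<And>i. i \<le> len g \<Longrightarrow> i \<le> cut n g \<longleftrightarrow> pos (pre i g) \<le> n"
proof -
  let ?A = "{i. i \<le> len g \<and> pos (pre i g) \<le> n}"
  have fin: "finite ?A" by simp
  have "0 \<in> ?A" by (simp add: pre_0 pos_one)
  then have "cut n g \<in> ?A" unfolding cut_def using fin by (intro Max_in) auto
  then show "cut n g \<le> len g" by simp
  show "i \<le> cut n g \<longleftrightarrow> pos (pre i g) \<le> n" if "i \<le> len g" for i
  proof
    assume "i \<le> cut n g"
    then show "pos (pre i g) \<le> n"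
      using \<open>cut n g \<in> ?A\<close> pos_pre_mono[OF assms, of i "cut n g"] by simp
  next
    assume "pos (pre i g) \<le> n"
    then show "i \<le> cut n g"
      unfolding cut_def using that fin by (intro Max_ge) auto
  qed
qed

lemma cut_unique:
  assumes "g \<in> carrier G" "j \<le> len g" "\<And>i. i \<le> len g \<Longrightarrow> i \<le> j \<longleftrightarrow> pos (pre i g) \<le> n"
  shows "cut n g = j"
  using assms cut_le[OF assms(1), of n] le_cut_iff[OF assms(1), of _ n] by (meson dual_order.antisym order_refl)

lemma retr_closed: "g \<in> carrier G \<Longrightarrow> retr n g \<in> carrier G"
  by (simp add: retr_def pre_closed)

lemma pos_retr: "g \<in> carrier G \<Longrightarrow> pos (retr n g) \<le> n"
  using le_cut_iff[of g "cut n g" n] cut_le[of g n] by (simp add: retr_def)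

lemma retr_fix: "g \<in> carrier G \<Longrightarrow> pos g \<le> n \<Longrightarrow> retr n g = g"
  using le_cut_iff[of g "len g" n] by (simp add: retr_def pre_all)

lemma retr_image: "retr n ` carrier G = {g \<in> carrier G. pos g \<le> n}"
  using retr_closed pos_retr retr_fix by (force simp: image_iff)

text \<open>The ancestors of \<open>pre a g\<close> are those of g of depth at most a. Hence both a
  second cut and a cut at \<open>min n k\<close> stop at the smaller of the two depths.\<close>

lemma retr_retr:
  assumes g: "g \<in> carrier G"
  shows "retr n (retr k g) = retr (min n k) g"
proof -
  define a where "a = cut k g"
  have a: "a \<le> len g" using cut_le[OF g] by (simp add: a_def)
  have "cut n (pre a g) = min (cut n g) a"
  proof (rule cut_unique)
    show "i \<le> min (cut n g) a \<longleftrightarrow> pos (pre i (pre a g)) \<le> n" if "i \<le> len (pre a g)" for i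
      using that a le_cut_iff[OF g, of i n] by (simp add: pre_pre[OF g] len_pre[OF g] min_absorb1)
  qed (use g a in \<open>simp_all add: pre_closed len_pre\<close>)
  moreover have "cut (min n k) g = min (cut n g) a"
  proof (rule cut_unique[OF g])
    show "i \<le> min (cut n g) a \<longleftrightarrow> pos (pre i g) \<le> min n k" if "i \<le> len g" for i
      using le_cut_iff[OF g that] by (simp add: a_def)
  qed (use a in simp)
  ultimately show ?thesis by (simp add: retr_def pre_pre[OF g] flip: a_def)
qed

lemma retr_0: "g \<in> carrier G \<Longrightarrow> retr 0 g = \<one>\<^bsub>G\<^esub>"
  using pos_retr[of g 0] pos_one inj_onD[OF inj _ retr_closed[of g 0] one_closed] by simp

text \<open>With no element at position n + 1, the retracted point already has position at most n
  and is fixed by \<open>retr n\<close>.\<close>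

lemma retr_Suc_eq:
  assumes "g \<in> carrier G" "Suc n \<notin> pos ` carrier G"
  shows "retr (Suc n) g = retr n g"
proof -
  have "pos (retr (Suc n) g) \<le> n"
    using pos_retr[OF assms(1), of "Suc n"] assms retr_closed[of g "Suc n"] by (metis imageI le_SucE)
  then show ?thesis
    using retr_fix[OF retr_closed[OF assms(1)], of "Suc n" n] retr_retr[OF assms(1), of n "Suc n"] by simp
qed

text \<open>The range of each retraction lies between two consecutive balls around the identity,
  so a retraction differs by at most one letter from truncation at a fixed length.\<close>

lemma retr_near_pre:
  obtains k where "\<And>g. g \<in> carrier G \<Longrightarrow> d (retr n g) (pre k g) \<le> 1"
proof -
  let ?A = "{g \<in> carrier G. pos g \<le> n}"
  \<comment> \<open>The greatest length attained in the range of \<open>retr n\<close>: every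
    element shorter than k precedes an element y of length k and so lies in the range as
    well.\<close>
  define k where "k = Max (len ` ?A)"
  have "finite (pos ` ?A)" by (rule finite_subset[of _ "{..n}"]) auto
  then have fin: "finite ?A" using inj by (auto intro: finite_imageD inj_on_subset)
  have "\<one>\<^bsub>G\<^esub> \<in> ?A" by (simp add: pos_one)
  then have "k \<in> len ` ?A" unfolding k_def using fin by (intro Max_in) auto
  then obtain y where y: "y \<in> carrier G" "pos y \<le> n" "len y = k" by auto
  have below: "pos g \<le> n" if "g \<in> carrier G" "len g < k" for g
    using pos_mono[OF that(1) y(1)] that y by simp
  show thesis
  proof (rule that)
    fix g assume g: "g \<in> carrier G"
    show "d (retr n g) (pre k g) \<le> 1"
    proof (cases "len g < k")
      case True
      then show ?thesis using g below by (simp add: retr_fix pre_all)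
    next
      case False
      have "len (retr n g) \<le> k"
        unfolding k_def using fin g retr_closed pos_retr by (intro Max_ge) auto
      then have "cut n g \<le> k"
        using cut_le[OF g, of n] by (simp add: retr_def len_pre[OF g])
      \<comment> \<open>The ancestor of g at depth k - 1 is shorter than k and so survives the cut;
        for k = 0 the truncated subtraction makes the bound trivial.\<close>
      moreover have "k - 1 \<le> cut n g"
      proof (cases "k = 0")
        case False
        then show ?thesis
          using \<open>\<not> len g < k\<close> le_cut_iff[OF g, of "k - 1" n] below[of "pre (k - 1) g"] g
          by (simp add: pre_closed len_pre)
      qed simp
      ultimately have "k = cut n g \<or> k = Suc (cut n g)" by linarith
      then show ?thesis
        using d_pre_Suc[OF g, of "cut n g"] d_sym[OF pre_closed pre_closed, OF g g]
        by (auto simp: retr_def)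
    qed
  qed
qed

text \<open>For adjacent points, pass through the truncations of both at one common depth k: each
  retraction is within one letter of its truncation, and the truncations are within K. This yields
  the constant K + 2.\<close>

lemma retr_lipschitz:
  assumes K: "K \<ge> 1"
    and comb: "\<And>g h i. g \<in> carrier G \<Longrightarrow> h \<in> carrier G \<Longrightarrow> d g h = 1 \<Longrightarrow> i \<le> min (len g) (len h)
      \<Longrightarrow> real (d (pre i g) (pre i h)) \<le> K"
    and xy: "x \<in> carrier G" "y \<in> carrier G"
  shows "real (d (retr n x) (retr n y)) \<le> (K + 2) * real (d x y)"
proof (rule lipschitz_of_adjacent[OF _ _ _ xy])
  obtain k where k: "\<And>g. g \<in> carrier G \<Longrightarrow> d (retr n g) (pre k g) \<le> 1"
    using retr_near_pre[of n] by blast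
  fix g h assume gh: "g \<in> carrier G" "h \<in> carrier G" "d g h = 1"
  have "d h g = 1" using d_sym gh by simp
  have "len g \<le> Suc (len h)" "len h \<le> Suc (len g)"
    using d_triangle[OF gh(1,2) one_closed] d_triangle[OF gh(2,1) one_closed] gh(3) \<open>d h g = 1\<close>
    by simp_all
  \<comment> \<open>Combability speaks only of depths up to the smaller length. Adjacent elements
    differ in length by at most one, so a larger k reaches both lengths and the truncations are g
    and h themselves.\<close>
  then consider "k \<le> min (len g) (len h)" | "len g \<le> k" "len h \<le> k" by linarith
  then have mid: "real (d (pre k g) (pre k h)) \<le> K"
  proof cases
    case 1
    then show ?thesis using comb gh by blast
  next
    case 2
    then show ?thesis using gh K by (simp add: pre_all)
  qed
  have "d (retr n g) (retr n h) \<le> d (retr n g) (pre k g) + d (pre k g) (retr n h)"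
    using gh by (intro d_triangle pre_closed retr_closed)
  also have "d (pre k g) (retr n h) \<le> d (pre k g) (pre k h) + d (pre k h) (retr n h)"
    using gh by (intro d_triangle pre_closed retr_closed)
  also have "d (pre k h) (retr n h) = d (retr n h) (pre k h)"
    using gh by (intro d_sym pre_closed retr_closed)
  finally have "d (retr n g) (retr n h) \<le> d (pre k g) (pre k h) + 2"
    using k[OF gh(1)] k[OF gh(2)] by linarith
  then show "real (d (retr n g) (retr n h)) \<le> K + 2" using mid by linarith
qed (use K retr_closed in auto)

lemma Schauder_basis_of_combing:
  assumes K: "K \<ge> 1"
    and comb: "\<And>g h i. g \<in> carrier G \<Longrightarrow> h \<in> carrier G \<Longrightarrow> d g h = 1 \<Longrightarrow> i \<le> min (len g) (len h)
      \<Longrightarrow> real (d (pre i g) (pre i h)) \<le> K"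
    and p: "p \<in> carrier G"
  shows "has_Schauder_basis (Lipschitz_free (word_metric G S) p)
           (Lip0_dual_norm (word_metric G S) p)"
proof -
  \<comment> \<open>The index is shifted by one: position 0 is the identity, the whole range of
    \<open>retr 0\<close>, and the n-th basis vector belongs to the element at position n +
    1.\<close>
  define I where "I = {n. Suc n \<in> pos ` carrier G}"
  define u where "u n = inv_into (carrier G) pos (Suc n)" for n
  have I: "I = UNIV \<or> (\<exists>n. I = {..<n})"
  proof (cases "I = UNIV")
    case False
    define N where "N = (LEAST n. n \<notin> I)"
    have "\<exists>n. n \<notin> I" using False by auto
    then have "N \<notin> I" unfolding N_def by (rule LeastI_ex)
    moreover have "n \<in> I" if "n < N" for n
      using that not_less_Least unfolding N_def by blast
    moreover have "k \<in> I" if "n \<in> I" "k \<le> n" for n k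
      using that pos_down by (force simp: I_def)
    ultimately have "I = {..<N}" by (metis lessThan_iff not_le subsetI subset_antisym)
    then show ?thesis by blast
  qed simp
  have u: "u n \<in> carrier G" "pos (u n) = Suc n" if "n \<in> I" for n
    using that inv_into_into[of "Suc n" pos "carrier G"] f_inv_into_f[of "Suc n" pos "carrier G"]
    by (auto simp: I_def u_def)
  note M = mspace_word_metric[OF group generating]
  show ?thesis
  proof (rule has_Schauder_basis_retractions[where R = retr and I = I and u = u and L = "K + 2"])
    fix n x y assume "x \<in> mspace (word_metric G S)" "y \<in> mspace (word_metric G S)"
    then show "mdist (word_metric G S) (retr n x) (retr n y) \<le> (K + 2) * mdist (word_metric G S) x y"
      using retr_lipschitz[OF K comb] by (simp add: M mdist_word_metric[OF group generating] retr_closed)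
  next
    fix n assume n: "n \<in> I"
    have "{g \<in> carrier G. pos g \<le> Suc n} = insert (u n) {g \<in> carrier G. pos g \<le> n}"
    proof
      show "{g \<in> carrier G. pos g \<le> Suc n} \<subseteq> insert (u n) {g \<in> carrier G. pos g \<le> n}"
      proof
        fix g assume "g \<in> {g \<in> carrier G. pos g \<le> Suc n}"
        then show "g \<in> insert (u n) {g \<in> carrier G. pos g \<le> n}"
          using inj_onD[OF inj, of g "u n"] u[OF n] by (cases "pos g = Suc n") simp_all
      qed
    qed (use u[OF n] in auto)
    then show "u n \<in> mspace (word_metric G S) - retr n ` mspace (word_metric G S) \<and>
        retr (Suc n) ` mspace (word_metric G S) = insert (u n) (retr n ` mspace (word_metric G S))"
      unfolding M retr_image using u[OF n] by simp
  next
    fix x assume "x \<in> mspace (word_metric G S)"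
    then have "retr n x = x" if "n \<ge> pos x" for n
      using retr_fix that by (simp add: M)
    then show "\<forall>\<^sub>F n in sequentially. retr n x = x"
      by (rule eventually_mono[OF eventually_ge_at_top])
  next
    show "I = UNIV \<or> (\<exists>n. I = {..<n})" by (rule I)
  qed (use p K in \<open>simp_all add: M I_def retr_closed retr_retr retr_0 retr_Suc_eq\<close>)
qed

end

end

theorem theorem2:
  fixes G :: "('a, 'b) monoid_scheme" and S :: "'a set" and r :: "('a \<times> 'a) set" and p :: 'a
  assumes "group G"
    and "finite S"
    and "symmetric_generating_set G S"
    and "linear_order_on S r"
    and "shortlex_combable G S r"
    and "p \<in> carrier G"
  shows "has_Schauder_basis (Lipschitz_free (word_metric G S) p)
           (Lip0_dual_norm (word_metric G S) p)"
proof -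
  interpret shortlex_group G S r
    by (rule shortlex_group.intro[OF assms(1-4)])
  obtain K :: real where K: "K \<ge> 1"
    "\<And>g h i. g \<in> carrier G \<Longrightarrow> h \<in> carrier G \<Longrightarrow> d g h = 1 \<Longrightarrow> i \<le> min (len g) (len h)
      \<Longrightarrow> real (d (pre i g) (pre i h)) \<le> K"
    using assms(5) unfolding shortlex_combable_def pre_def by blast
  obtain pos :: "'a \<Rightarrow> nat"
    where "inj_on pos (carrier G)"
      "\<And>a b. a \<in> carrier G \<Longrightarrow> b \<in> carrier G \<Longrightarrow> len a < len b \<Longrightarrow> pos a < pos b"
      "\<And>a k. a \<in> carrier G \<Longrightarrow> k \<le> pos a \<Longrightarrow> k \<in> pos ` carrier G"
    by (rule ex_position) (rule that; assumption)
  from Schauder_basis_of_combing[OF this K assms(6)] show ?thesis .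
qed

end
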